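(* Let $\mathcal M_m$ be the set of all $m\times m$ positive semidefinite correlation matrices (possibly with negative entries). For $\Sigma\in\mathcal M_m$ let $X\sim N(0,\Sigma)$ and $P_i=\Phi(-X_i)$ for $i=1,\dots,m$, where $\Phi$ is the standard normal CDF. Then the arithmetic average $\bar P=\frac1m\sum_{i=1}^mP_i$ satisfies $$\sup_{\Sigma\in\mathcal M_m}\Pr(\bar P\le\alpha)\le\alpha\qquad\text{for any }\alpha\in\big(0,\tfrac1{2m}\big).$$
   Context: A correlation matrix is a symmetric positive semidefinite matrix with unit diagonal. *)

theory Defs
  imports "HOL-Probability.Probability"
begin

definition pos_semidef :: "real ^ 'm ^ 'm \<Rightarrow> bool" where
  "pos_semidef A \<longleftrightarrow> transpose A = A \<and> (\<forall>x. 0 \<le> x \<bullet> (A *v x))"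

definition correlation_matrices :: "(real ^ 'm ^ 'm) set" where
  "correlation_matrices = {A. pos_semidef A \<and> (\<forall>i. A $ i $ i = 1)}"

text \<open>The second parameter is the variance \<open>v\<close>, whereas \<^const>\<open>normal_density\<close> takes the standard
  deviation. Variance zero gives the point mass at \<open>m\<close>.\<close>

definition normal_law :: "real \<Rightarrow> real \<Rightarrow> real measure" where
  "normal_law m v =
    (if v = 0 then return borel m else density lborel (\<lambda>x. ennreal (normal_density m (sqrt v) x)))"

text \<open>\<open>X\<close> has law \<open>N(\<mu>, \<Sigma>)\<close> iff every linear combination of its coordinates is univariate normal
  (possibly degenerate) with the corresponding mean and variance. No density on the whole space is
  required, so singular \<open>\<Sigma>\<close> is covered.\<close>

definition multivariate_normal ::
    "'a measure \<Rightarrow> ('a \<Rightarrow> real ^ 'm) \<Rightarrow> real ^ 'm \<Rightarrow> real ^ 'm ^ 'm \<Rightarrow> bool" where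
  "multivariate_normal M X \<mu> \<Sigma> \<longleftrightarrow>
     prob_space M \<and> X \<in> borel_measurable M \<and> pos_semidef \<Sigma> \<and>
     (\<forall>a. distr M borel (\<lambda>\<omega>. a \<bullet> X \<omega>) = normal_law (a \<bullet> \<mu>) (a \<bullet> (\<Sigma> *v a)))"

definition std_normal_cdf :: "real \<Rightarrow> real" where
  "std_normal_cdf x = cdf std_normal_distribution x"

definition p_value :: "real ^ 'm \<Rightarrow> 'm \<Rightarrow> real" where
  "p_value x i = std_normal_cdf (- (x $ i))"

definition mean_p_value :: "real ^ 'm \<Rightarrow> real" where
  "mean_p_value x = (\<Sum>i\<in>UNIV. p_value x i) / real CARD('m)"

text \<open>The supremum of a real-valued family over \<^const>\<open>correlation_matrices\<close> is only meaningful if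
  this set is nonempty and the family is bounded above; the latter is automatic for probabilities.\<close>

lemma correlation_matrices_nonempty: "correlation_matrices \<noteq> {}"
proof -
  have "(mat 1 :: real ^ 'm ^ 'm) \<in> correlation_matrices"
    by (auto simp: correlation_matrices_def pos_semidef_def transpose_mat) (simp add: mat_def)
  then show ?thesis by blast
qed

end

theory Submission
  imports Defs
begin

text \<open>
  Write \<open>\<Phi>\<close> for the standard normal distribution function. The threshold \<open>1 / (2 m)\<close> is what makes
  convexity available. All p-values are nonnegative, so if their mean is at most \<open>\<alpha> < 1 / (2 m)\<close>,
  each of them is below \<open>1 / 2 \<le> \<Phi> 0\<close>, and therefore every coordinate \<open>X\<^sub>i\<close> is positive
  (\<open>coordinate_pos_if_mean_p_value_less\<close>). On the negative half-line \<open>\<Phi>\<close> is convex, because its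
  derivative, the Gaussian density, increases there. Jensen's inequality then says that the p-value
  of the averaged statistic \<open>Y\<close>, the mean of the \<open>X\<^sub>i\<close>, is at most the mean p-value
  (\<open>mean_p_value_ge_p_value_of_mean\<close>). Hence the event that the mean p-value is at most \<open>\<alpha>\<close> is
  contained in the event \<open>Y \<ge> z\<close>, where \<open>z > 0\<close> is the quantile with \<open>\<Phi> (- z) = \<alpha>\<close>.

  The dependence structure now enters only through the variance of \<open>Y\<close>, which is a centred normal
  variable. Correlations are at most \<open>1\<close>, so this variance is at most \<open>1\<close>
  (\<open>correlation_quadratic_form_le_1\<close>), and shrinking the variance of a centred normal variable
  lowers the probability of exceeding a positive level (\<open>normal_law_upper_tail_le\<close>). The event
  \<open>Y \<ge> z\<close> therefore has probability at most \<open>\<Phi> (- z) = \<alpha>\<close>, uniformly in the correlation matrix.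
\<close>

text \<open>The improper integral defining \<open>\<Phi>\<close> is split off at a point \<open>a\<close> to the left of \<open>x\<close>, so that the
  fundamental theorem of calculus on a compact interval applies. The derivative gives both the
  strict monotonicity and the convexity on \<open>{..0}\<close> of \<open>\<Phi>\<close>.\<close>

lemma std_normal_cdf_has_derivative:
  "(std_normal_cdf has_real_derivative std_normal_density x) (at x)"
proof -
  interpret real_distribution std_normal_distribution
    by (rule real_dist_normal_dist)
  have cont: "continuous_on S std_normal_density" for S :: "real set"
    unfolding std_normal_density_def by (intro continuous_intros) auto
  have increment: "std_normal_cdf y = std_normal_cdf a + integral {a..y} std_normal_density"
    if "a < y" for a y
  proof -
    have int: "set_integrable lborel {a<..y} std_normal_density"
      unfolding set_integrable_def by (intro integrable_mult_indicator) auto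
    have "std_normal_cdf y - std_normal_cdf a = measure std_normal_distribution {a<..y}"
      using cdf_diff_eq[OF that] by (simp add: std_normal_cdf_def)
    also have "\<dots> = (LINT t|std_normal_distribution. indicator {a<..y} t)"
      by simp
    also have "\<dots> = (LINT t:{a<..y}|lborel. std_normal_density t)"
      by (subst integral_density) (auto simp: set_lebesgue_integral_def mult.commute)
    also have "\<dots> = integral {a<..y} std_normal_density"
      by (rule set_borel_integral_eq_integral[OF int])
    also have "\<dots> = integral {a..y} std_normal_density"
      by (rule integral_spike_set) (auto intro: negligible_subset[of "{a}"])
    finally show ?thesis by simp
  qed
  have "((\<lambda>y. std_normal_cdf (x - 1) + integral {x - 1..y} std_normal_density)
      has_real_derivative std_normal_density x) (at x within {x - 1..x + 1})"
    by (auto intro!: derivative_eq_intros integral_has_real_derivative cont)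
  then have "((\<lambda>y. std_normal_cdf (x - 1) + integral {x - 1..y} std_normal_density)
      has_real_derivative std_normal_density x) (at x)"
    by (subst (asm) at_within_interior) auto
  moreover have "\<forall>\<^sub>F y in nhds x. std_normal_cdf (x - 1) + integral {x - 1..y} std_normal_density
      = std_normal_cdf y"
    by (rule eventually_mono[OF eventually_nhds_in_open[of "{x - 1<..}" x]])
      (auto simp: increment)
  ultimately show ?thesis
    by (simp cong: DERIV_cong_ev)
qed

lemma strict_mono_std_normal_cdf: "strict_mono std_normal_cdf"
  by (auto intro!: strict_monoI DERIV_pos_imp_increasing[where f = std_normal_cdf]
      std_normal_cdf_has_derivative normal_density_pos)

lemma std_normal_cdf_nonneg: "0 \<le> std_normal_cdf x"
  by (simp add: std_normal_cdf_def cdf_def)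

lemma convex_on_std_normal_cdf: "convex_on {..0} std_normal_cdf"
proof (rule convex_on_realI[OF _ std_normal_cdf_has_derivative])
  fix x y :: real
  assume "x \<in> {..0}" "y \<in> {..0}" "x \<le> y"
  then have "y\<^sup>2 \<le> x\<^sup>2"
    by (simp add: abs_le_square_iff[symmetric])
  then show "std_normal_density x \<le> std_normal_density y"
    by (simp add: std_normal_density_def divide_right_mono)
qed simp

text \<open>Scaling a standard normal variable by \<open>- \<sigma>\<close> gives the law \<open>N(0, \<sigma>\<^sup>2)\<close> and turns the upper tail
  at \<open>z\<close> into the lower tail at \<open>- z / \<sigma>\<close>. The negative sign thus takes care of the symmetry of
  the density and of the change of scale at the same time.\<close>

lemma normal_upper_tail:
  assumes "0 < \<sigma>"
  shows "measure (density lborel (normal_density 0 \<sigma>)) {z..} = std_normal_cdf (- z / \<sigma>)"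
proof -
  interpret prob_space std_normal_distribution
    by (rule prob_space_normal_density) simp
  have "distributed std_normal_distribution lborel (\<lambda>x. x) std_normal_density"
    by (auto simp: distributed_def distr_id2)
  from normal_density_affine[OF this, of "- \<sigma>" 0] assms
  have "distr std_normal_distribution lborel (\<lambda>x. - \<sigma> * x) = density lborel (normal_density 0 \<sigma>)"
    by (auto simp: distributed_def)
  then have "measure (density lborel (normal_density 0 \<sigma>)) {z..}
      = measure (distr std_normal_distribution lborel (\<lambda>x. - \<sigma> * x)) {z..}"
    by simp
  also have "\<dots> = measure std_normal_distribution {.. - z / \<sigma>}"
    using assms by (subst measure_distr) (auto intro!: arg_cong2[where f = measure] simp: field_simps)
  finally show ?thesis
    by (simp add: std_normal_cdf_def cdf_def)
qed

text \<open>The two closed half-lines at \<open>0\<close> cover the real line and have equal mass by symmetry.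
  The bound forces a p-value below \<open>1 / 2\<close> to come from a positive observation.\<close>

lemma std_normal_cdf_0_ge: "1 / 2 \<le> std_normal_cdf 0"
proof -
  interpret real_distribution std_normal_distribution
    by (rule real_dist_normal_dist)
  have "{..0} \<union> {0..} = space std_normal_distribution"
    by auto
  then have "1 = prob ({..0} \<union> {0..})"
    by (simp only: prob_space)
  also have "\<dots> \<le> prob {..0} + prob {0..}"
    by (intro measure_Un_le) auto
  also have "\<dots> = 2 * std_normal_cdf 0"
    using normal_upper_tail[of 1 0] by (simp add: std_normal_cdf_def cdf_def)
  finally show ?thesis by simp
qed

lemma std_normal_quantile:
  assumes "0 < \<alpha>" "\<alpha> < 1 / 2"
  obtains z where "0 < z" "std_normal_cdf (- z) = \<alpha>"
proof -
  interpret real_distribution std_normal_distribution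
    by (rule real_dist_normal_dist)
  have "\<forall>\<^sub>F x in at_bot. std_normal_cdf x < \<alpha>"
    unfolding std_normal_cdf_def by (rule order_tendstoD(2)[OF cdf_lim_at_bot assms(1)])
  then obtain b where "std_normal_cdf b < \<alpha>" "b \<le> 0"
    by (metis eventually_at_bot_linorder nle_le order_refl)
  moreover have "\<alpha> < std_normal_cdf 0"
    using assms std_normal_cdf_0_ge by simp
  moreover have "continuous_on {b..0} std_normal_cdf"
    by (meson DERIV_continuous_on has_field_derivative_at_within std_normal_cdf_has_derivative)
  ultimately obtain y where "y \<le> 0" "std_normal_cdf y = \<alpha>"
    using IVT'[of std_normal_cdf b \<alpha> 0] by auto
  moreover from this have "y \<noteq> 0"
    using \<open>\<alpha> < std_normal_cdf 0\<close> by auto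
  ultimately show thesis
    using that[of "- y"] by simp
qed

text \<open>After standardisation the level \<open>z\<close> becomes \<open>z / sqrt v \<ge> z\<close>; positivity of \<open>z\<close> is essential
  here. It also ensures that the point mass at \<open>0\<close>, the case \<open>v = 0\<close>, does not reach the tail. This
  case does occur: the average of the coordinates vanishes for two perfectly anticorrelated
  variables.\<close>

lemma normal_law_upper_tail_le:
  assumes "0 \<le> v" "v \<le> 1" "0 < z"
  shows "measure (normal_law 0 v) {z..} \<le> std_normal_cdf (- z)"
proof (cases "v = 0")
  case True
  then show ?thesis
    using assms by (simp add: normal_law_def measure_return std_normal_cdf_nonneg)
next
  case False
  with assms have "0 < sqrt v" "sqrt v \<le> 1" by simp_all
  then have "z \<le> z / sqrt v"
    using assms by (simp add: field_simps mult_left_le)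
  then show ?thesis
    using False \<open>0 < sqrt v\<close>
    by (simp add: normal_law_def normal_upper_tail strict_mono_less_eq[OF strict_mono_std_normal_cdf])
qed

text \<open>The quadratic form at the difference of the \<open>i\<close>-th and \<open>j\<close>-th unit vectors, which is the variance
  of \<open>X\<^sub>i - X\<^sub>j\<close>, equals \<open>2 - 2 \<Sigma>\<^sub>i\<^sub>j\<close>.\<close>

lemma correlation_entry_le_1:
  fixes \<Sigma> :: "real ^ 'm ^ 'm"
  assumes "\<Sigma> \<in> correlation_matrices"
  shows "\<Sigma> $ i $ j \<le> 1"
proof -
  have "\<Sigma> $ i $ i = 1" "\<Sigma> $ j $ j = 1" and "transpose \<Sigma> = \<Sigma>"
    and psd: "0 \<le> (axis i 1 - axis j 1) \<bullet> (\<Sigma> *v (axis i 1 - axis j 1))"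
    using assms by (auto simp: correlation_matrices_def pos_semidef_def)
  moreover from \<open>transpose \<Sigma> = \<Sigma>\<close> have "\<Sigma> $ j $ i = \<Sigma> $ i $ j"
    by (metis transpose_def vec_lambda_beta)
  moreover have "axis k 1 \<bullet> (\<Sigma> *v axis l 1) = \<Sigma> $ k $ l" for k l
    by (simp add: inner_axis' matrix_vector_mul_component inner_axis)
  ultimately show ?thesis
    by (simp add: matrix_vector_mult_diff_distrib inner_diff_left inner_diff_right)
qed

text \<open>A weighted average of standardised variables has its largest variance when all of them coincide;
  with nonnegative weights an upper bound on the correlations suffices for this.\<close>

lemma correlation_quadratic_form_le_1:
  fixes \<Sigma> :: "real ^ 'm ^ 'm"
  assumes "\<Sigma> \<in> correlation_matrices" "\<And>i. 0 \<le> a $ i" "(\<Sum>i\<in>UNIV. a $ i) = 1"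
  shows "a \<bullet> (\<Sigma> *v a) \<le> 1"
proof -
  have "a \<bullet> (\<Sigma> *v a) = (\<Sum>i\<in>UNIV. \<Sum>j\<in>UNIV. a $ i * a $ j * \<Sigma> $ i $ j)"
    by (simp add: inner_vec_def matrix_vector_mult_def sum_distrib_left mult_ac)
  also have "\<dots> \<le> (\<Sum>i\<in>UNIV. \<Sum>j\<in>UNIV. a $ i * a $ j)"
    using assms correlation_entry_le_1 by (intro sum_mono mult_left_le) auto
  also have "\<dots> = (\<Sum>i\<in>UNIV. a $ i) * (\<Sum>j\<in>UNIV. a $ j)"
    by (simp add: sum_product)
  finally show ?thesis
    using assms by simp
qed

text \<open>A single nonpositive coordinate has a p-value of at least \<open>1 / 2\<close> and thus already contributes
  \<open>1 / (2 m)\<close> to the mean.\<close>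

lemma coordinate_pos_if_mean_p_value_less:
  fixes x :: "real ^ 'm"
  assumes "mean_p_value x < 1 / (2 * real CARD('m))"
  shows "0 < x $ i"
proof -
  have "p_value x i \<le> (\<Sum>j\<in>UNIV. p_value x j)"
    by (intro member_le_sum) (auto simp: p_value_def std_normal_cdf_nonneg)
  also have "\<dots> < 1 / 2"
    using assms by (simp add: mean_p_value_def field_simps)
  finally have "std_normal_cdf (- x $ i) < std_normal_cdf 0"
    using std_normal_cdf_0_ge by (simp add: p_value_def)
  then show ?thesis
    by (simp add: strict_mono_less[OF strict_mono_std_normal_cdf])
qed

text \<open>Jensen's inequality at the points \<open>- x\<^sub>i\<close>, which lie in the region of convexity of \<open>\<Phi>\<close>. The mean
  of the coordinates is written as an inner product with the constant vector \<open>1 / m\<close>, because the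
  law of a Gaussian vector is specified through inner products.\<close>

lemma mean_p_value_ge_p_value_of_mean:
  fixes x :: "real ^ 'm"
  assumes "\<And>i. 0 \<le> x $ i"
  shows "std_normal_cdf (- ((\<chi> i. 1 / real CARD('m)) \<bullet> x)) \<le> mean_p_value x"
proof -
  have "std_normal_cdf (\<Sum>i\<in>UNIV. (1 / real CARD('m)) *\<^sub>R (- x $ i))
      \<le> (\<Sum>i\<in>UNIV. (1 / real CARD('m)) * std_normal_cdf (- x $ i))"
    using assms by (intro convex_on_sum[OF _ _ convex_on_std_normal_cdf]) auto
  then show ?thesis
    by (simp add: inner_vec_def mean_p_value_def p_value_def sum_negf sum_divide_distrib)
qed

theorem corollary1:
  fixes M :: "real ^ 'm ^ 'm \<Rightarrow> 'a measure"
    and X :: "real ^ 'm ^ 'm \<Rightarrow> 'a \<Rightarrow> real ^ 'm"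
    and \<alpha> :: real
  assumes "\<And>\<Sigma>. \<Sigma> \<in> correlation_matrices \<Longrightarrow> multivariate_normal (M \<Sigma>) (X \<Sigma>) 0 \<Sigma>"
    and "\<alpha> \<in> {0<..<1 / (2 * real CARD('m))}"
  shows "(SUP \<Sigma>\<in>correlation_matrices. \<P>(\<omega> in M \<Sigma>. mean_p_value (X \<Sigma> \<omega>) \<le> \<alpha>)) \<le> \<alpha>"
proof (rule cSUP_least[OF correlation_matrices_nonempty])
  fix \<Sigma> :: "real ^ 'm ^ 'm"
  assume \<Sigma>: "\<Sigma> \<in> correlation_matrices"
  define a :: "real ^ 'm" where "a = (\<chi> i. 1 / real CARD('m))"
  have law: "distr (M \<Sigma>) borel (\<lambda>\<omega>. a \<bullet> X \<Sigma> \<omega>) = normal_law 0 (a \<bullet> (\<Sigma> *v a))"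
    and [measurable]: "X \<Sigma> \<in> borel_measurable (M \<Sigma>)"
    and "prob_space (M \<Sigma>)" and var_nonneg: "0 \<le> a \<bullet> (\<Sigma> *v a)"
    using assms(1)[OF \<Sigma>] by (auto simp: multivariate_normal_def pos_semidef_def)
  interpret prob_space "M \<Sigma>" by fact
  have var_le: "a \<bullet> (\<Sigma> *v a) \<le> 1"
    by (rule correlation_quadratic_form_le_1[OF \<Sigma>]) (auto simp: a_def)
  have \<alpha>: "0 < \<alpha>" "\<alpha> < 1 / (2 * real CARD('m))"
    using assms(2) by auto
  have "1 / (2 * real CARD('m)) \<le> 1 / 2"
    by (simp add: field_simps Suc_le_eq)
  with \<alpha>(2) have "\<alpha> < 1 / 2"
    by (rule less_le_trans)
  with \<alpha>(1) obtain z where z: "0 < z" "std_normal_cdf (- z) = \<alpha>"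
    by (rule std_normal_quantile)
  have mean_ge: "z \<le> a \<bullet> x" if "mean_p_value x \<le> \<alpha>" for x :: "real ^ 'm"
  proof -
    have "0 < x $ i" for i
      using that \<alpha> by (intro coordinate_pos_if_mean_p_value_less) simp
    then have "std_normal_cdf (- (a \<bullet> x)) \<le> mean_p_value x"
      unfolding a_def by (intro mean_p_value_ge_p_value_of_mean less_imp_le)
    with that z have "std_normal_cdf (- (a \<bullet> x)) \<le> std_normal_cdf (- z)"
      by simp
    then show ?thesis
      by (simp add: strict_mono_less_eq[OF strict_mono_std_normal_cdf])
  qed
  have "\<P>(\<omega> in M \<Sigma>. mean_p_value (X \<Sigma> \<omega>) \<le> \<alpha>) \<le> \<P>(\<omega> in M \<Sigma>. z \<le> a \<bullet> X \<Sigma> \<omega>)"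
    by (rule finite_measure_mono) (auto intro: mean_ge)
  also have "\<dots> = measure (distr (M \<Sigma>) borel (\<lambda>\<omega>. a \<bullet> X \<Sigma> \<omega>)) {z..}"
    by (subst measure_distr) (auto intro!: arg_cong2[where f = measure])
  also have "\<dots> \<le> \<alpha>"
    using normal_law_upper_tail_le[OF var_nonneg var_le z(1)] by (simp add: law z)
  finally show "\<P>(\<omega> in M \<Sigma>. mean_p_value (X \<Sigma> \<omega>) \<le> \<alpha>) \<le> \<alpha>" .
qed

end
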